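(* Let $G$ be a one-step $W$-groupoid and let $e,f\in G$ with $e\neq f$, $ef\neq fe$ and $G=\langle e,f\rangle$. If $\|e\|=3$, then $G$ is one of the following two quasigroups (in each table the entry in row $x$ and column $y$ is the product $xy$, and the elements labelling the rows are distinct and are all the elements of $G$). (1) If $e=(fef)f$, then $G$ has the following Cayley table: $$\begin{array}{c|ccccc} & e & f & ef & fe & fef\\ \hline e & e & ef & f & fef & fe\\ f & fe & f & fef & e & ef\\ ef & fef & fe & ef & f & e\\ fe & ef & fef & e & fe & f\\ fef & f & e & fe & ef & fef \end{array}$$ (2) If $e=f(fef)$, then $G$ has the following Cayley table, where $$(1,2,3,4,5,6,7,8,9,10,11)=(e,\ ef,\ fe,\ fef,\ f(fe),\ e(ef),\ efe,\ (ef)(fe),\ (fe)(ef),\ e(f(fe)),\ e(efe)):$$ $$\begin{array}{c|ccccccccccc} & 1&2&3&4&5&6&7&8&9&10&11\\ \hline 1 & 1&6&7&5&10&3&11&9&4&8&2\\ 2 & 7&2&8&9&1&5&10&4&11&6&3\\ 3 & 2&9&3&10&6&11&8&1&7&5&4\\ 4 & 8&3&6&4&7&9&1&11&10&2&5\\ 5 & 9&10&4&8&5&7&3&6&2&11&1\\ 6 & 11&7&10&2&4&6&9&3&5&1&8\\ 7 & 6&5&2&11&8&4&7&10&1&3&9\\ 8 & 5&11&9&7&3&1&2&8&6&4&10\\ 9 & 10&8&1&3&11&2&4&5&9&7&6\\ 10 & 4&1&11&6&9&8&5&2&3&10&7\\ 11 & 3&4&5&1&2&10&6&7&8&9&11 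\end{array}$$
   Context: A groupoid is a set with a binary operation, written by juxtaposition. $W$ is the variety of idempotent right modular groupoids, i.e. groupoids satisfying $xx=x$ and $(xy)z=(zy)x$ for all $x,y,z$. Every groupoid in $W$ satisfies $(xy)x=x(yx)$, and $xyx$ denotes this common value. A one-step $W$-groupoid is a non-commutative groupoid $G\in W$ (finite or infinite) such that every proper subgroupoid of $G$ is commutative. $\langle x,y\rangle$ denotes the subgroupoid generated by $x$ and $y$. In the situation of the claim, put $g=ef$; then it is known that $G=\langle f,g\rangle$. A word is a finite product of terms, each equal to $f$ or to $g=ef$, bracketed in any meaningful manner; its length is the number of such terms (counted with repetition, each occurrence of $f$ or of $ef$ counting as one term). For $x\in G$, $\|x\|$ denotes the minimum length of a word representing $x$. The number $\|e\|$ is called the dimension of $G$. *)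

theory Defs
  imports Main
begin

locale groupoid =
  fixes carrier :: "'a set" and mult :: "'a \<Rightarrow> 'a \<Rightarrow> 'a" (infixl "\<cdot>" 70)
  assumes closed: "x \<in> carrier \<Longrightarrow> y \<in> carrier \<Longrightarrow> x \<cdot> y \<in> carrier"

locale W_groupoid = groupoid +
  assumes idem: "x \<in> carrier \<Longrightarrow> x \<cdot> x = x"
    and right_modular:
      "x \<in> carrier \<Longrightarrow> y \<in> carrier \<Longrightarrow> z \<in> carrier \<Longrightarrow> (x \<cdot> y) \<cdot> z = (z \<cdot> y) \<cdot> x"

definition subgroupoid :: "'a set \<Rightarrow> 'a set \<Rightarrow> ('a \<Rightarrow> 'a \<Rightarrow> 'a) \<Rightarrow> bool" where
  "subgroupoid H G m \<longleftrightarrow> H \<subseteq> G \<and> groupoid H m"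

definition commutative_on :: "'a set \<Rightarrow> ('a \<Rightarrow> 'a \<Rightarrow> 'a) \<Rightarrow> bool" where
  "commutative_on H m \<longleftrightarrow> (\<forall>x\<in>H. \<forall>y\<in>H. m x y = m y x)"

locale one_step_W_groupoid = W_groupoid +
  assumes noncommutative: "\<not> commutative_on carrier mult"
    and proper_commutative:
      "subgroupoid H carrier mult \<Longrightarrow> H \<noteq> carrier \<Longrightarrow> commutative_on H mult"

definition generated_subgroupoid :: "'a set \<Rightarrow> ('a \<Rightarrow> 'a \<Rightarrow> 'a) \<Rightarrow> 'a set \<Rightarrow> 'a set" where
  "generated_subgroupoid G m S = \<Inter>{H. subgroupoid H G m \<and> S \<subseteq> H}"

locale quasigroup = groupoid +
  assumes left_division: "a \<in> carrier \<Longrightarrow> b \<in> carrier \<Longrightarrow> \<exists>!x. x \<in> carrier \<and> a \<cdot> x = b"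
    and right_division: "a \<in> carrier \<Longrightarrow> b \<in> carrier \<Longrightarrow> \<exists>!y. y \<in> carrier \<and> y \<cdot> a = b"

text \<open>Bracketed words in two letters; the letters \<open>F\<close> and \<open>EF\<close> stand for the terms
  \<open>f\<close> and \<open>g = ef\<close>, each of length one.\<close>

datatype gword = F | EF | Prod gword gword

fun word_length :: "gword \<Rightarrow> nat" where
  "word_length F = 1"
| "word_length EF = 1"
| "word_length (Prod u v) = word_length u + word_length v"

fun word_value :: "('a \<Rightarrow> 'a \<Rightarrow> 'a) \<Rightarrow> 'a \<Rightarrow> 'a \<Rightarrow> gword \<Rightarrow> 'a" where
  "word_value m e f F = f"
| "word_value m e f EF = m e f"
| "word_value m e f (Prod u v) = m (word_value m e f u) (word_value m e f v)"

text \<open>The least element below is meaningful when \<open>x\<close> is represented by some word,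
  i.e. lies in the subgroupoid generated by \<open>f\<close> and \<open>ef\<close>; for a one-step
  \<open>W\<close>-groupoid generated by non-commuting \<open>e\<close>, \<open>f\<close> this is every element.\<close>

definition word_norm :: "('a \<Rightarrow> 'a \<Rightarrow> 'a) \<Rightarrow> 'a \<Rightarrow> 'a \<Rightarrow> 'a \<Rightarrow> nat" where
  "word_norm m e f x = (LEAST n. \<exists>w. word_value m e f w = x \<and> word_length w = n)"

text \<open>\<open>xs\<close> lists the row and column labels in order; \<open>T\<close> is the list of rows of entries.\<close>

definition has_cayley_table ::
  "'a set \<Rightarrow> ('a \<Rightarrow> 'a \<Rightarrow> 'a) \<Rightarrow> 'a list \<Rightarrow> 'a list list \<Rightarrow> bool" where
  "has_cayley_table G m xs T \<longleftrightarrow>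
     distinct xs \<and> set xs = G \<and> map (\<lambda>x. map (\<lambda>y. m x y) xs) xs = T"

text \<open>Replaces each position, counted from 1, in a numbered table by the label at that position.\<close>

definition labelled :: "'a list \<Rightarrow> nat list list \<Rightarrow> 'a list list" where
  "labelled xs N = map (map (\<lambda>k. xs ! (k - 1))) N"

end

theory Submission
  imports Defs "HOL-Number_Theory.Residues"
begin

text \<open>
  Right multiplication by \<open>f\<close> is an endomorphism; let \<open>\<xi> k\<close> be the image of \<open>e\<close> under its
  \<open>k\<close>-th power. With \<open>g = ef\<close> we have \<open>gf = \<xi> 2\<close> and \<open>fg = \<xi> 3\<close>, and a word of length 3 that does
  not equal a shorter one is \<open>fgf = \<xi> 4\<close>, \<open>f(fg) = \<xi> 5\<close>, \<open>gfg\<close> or \<open>g(gf)\<close>. Since \<open>e = gfg\<close>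
  implies \<open>e = \<xi> 4\<close> and \<open>e = g(gf)\<close> implies \<open>e = \<xi> 3\<close>, norm 3 means that \<open>e\<close> has period 4 or 5.

  Over a field with \<open>a\<^sup>2 + a = 1\<close> the operation \<open>ax + (1 - a)y\<close> is idempotent and right modular,
  and \<open>f = 0\<close>, \<open>e = 1\<close> give \<open>\<xi> k = a\<^sup>k\<close>. Here \<open>a\<^sup>4 = 1\<close> forces \<open>\<int>/5\<close> and \<open>a = 2\<close>, while
  \<open>a\<^sup>5 = 1\<close> forces \<open>\<int>/11\<close> and \<open>a = 3\<close>; the table for \<open>G\<close> is the table of this operation. To see that
  the evident map from \<open>\<int>/p\<close> to \<open>G\<close> is a homomorphism it suffices to multiply by \<open>f\<close> and by \<open>e\<close>
  on the right, because the elements whose right multiplication is as expected are closed under products.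
  A non-injective homomorphism would be constant, contradicting \<open>ef \<noteq> fe\<close>, and the image of an
  injective one is not commutative, hence all of \<open>G\<close>.
\<close>

section \<open>Affine combinations of residues\<close>

lemma coprime_power_cong_1:
  fixes a p :: int
  assumes "coprime a p" and "0 < p"
  obtains n where "0 < n" and "[a ^ n = 1] (mod p)"
proof -
  define b q where "b = nat (a mod p)" and "q = nat p"
  have b: "int b = a mod p" and q: "int q = p"
    using \<open>0 < p\<close> by (simp_all add: b_def q_def)
  have "coprime (int b) (int q)"
    using assms by (simp add: b q coprime_mod_left_iff)
  then have "[b ^ totient q = 1] (mod q)"
    by (intro euler_theorem) (simp add: coprime_int_iff)
  then have "[int b ^ totient q = 1] (mod int q)"
    by (metis cong_int_iff of_nat_1 of_nat_power)
  then have "[a ^ totient q = 1] (mod p)"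
    by (simp add: b q cong_def power_mod)
  moreover have "0 < totient q"
    using \<open>0 < p\<close> by (simp add: q_def)
  ultimately show thesis
    by (rule that[rotated])
qed

lemma cong_solve_linear:
  fixes a p :: int
  assumes "coprime a p"
  obtains k where "[a * k = b] (mod p)"
proof -
  obtain u where "[a * u = 1] (mod p)"
    using cong_solve_coprime_int[OF assms] by blast
  then have "[a * u * b = 1 * b] (mod p)"
    by (rule cong_scalar_right)
  then have "[a * (u * b) = b] (mod p)"
    by (simp add: mult.assoc)
  then show thesis by (rule that)
qed

lemma translation_closed_eq_UNIV:
  fixes S :: "int set"
  assumes "0 < p" and "coprime d p" and "i \<in> S"
    and cong: "\<And>x y. x \<in> S \<Longrightarrow> [x = y] (mod p) \<Longrightarrow> y \<in> S"
    and translate: "\<And>x. x \<in> S \<Longrightarrow> x + d \<in> S"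
  shows "S = UNIV"
proof -
  have multiples: "i + d * int n \<in> S" for n
  proof (induction n)
    case (Suc n)
    then show ?case
      using translate[OF Suc] by (simp add: algebra_simps)
  qed (simp add: \<open>i \<in> S\<close>)
  have "t \<in> S" for t
  proof -
    obtain k where "[d * k = t - i] (mod p)"
      using cong_solve_linear \<open>coprime d p\<close> by blast
    then have "[i + d * (k mod p) = i + (t - i)] (mod p)"
      by (intro cong_add cong_refl) (simp add: cong_def mod_mult_right_eq)
    moreover have "i + d * (k mod p) \<in> S"
      using multiples \<open>0 < p\<close> by (metis pos_mod_sign zero_le_imp_eq_int)
    ultimately show ?thesis
      using cong by fastforce
  qed
  then show ?thesis by blast
qed

text \<open>If \<open>u\<close> is the inverse of \<open>a\<close>, then the map \<open>x \<mapsto> u x + (1 - u) i\<close> inverts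
  \<open>x \<mapsto> a x + (1 - a) i\<close>; composed with \<open>x \<mapsto> a x + (1 - a) j\<close> it is a translation.\<close>

lemma affine_closed_eq_UNIV:
  fixes S :: "int set"
  assumes "0 < p" and "coprime a p" and "coprime (1 - a) p"
    and "i \<in> S" and "j \<in> S" and "coprime (i - j) p"
    and cong: "\<And>x y. x \<in> S \<Longrightarrow> [x = y] (mod p) \<Longrightarrow> y \<in> S"
    and affine: "\<And>x y. x \<in> S \<Longrightarrow> y \<in> S \<Longrightarrow> a * x + (1 - a) * y \<in> S"
  shows "S = UNIV"
proof -
  have affine_power: "a ^ n * x + (1 - a ^ n) * y \<in> S" if "x \<in> S" "y \<in> S" for n x y
  proof (induction n)
    case (Suc n)
    then show ?case
      using affine[OF Suc \<open>y \<in> S\<close>] by (simp add: algebra_simps)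
  qed (simp add: that)
  obtain n where "0 < n" and "[a ^ n = 1] (mod p)"
    using coprime_power_cong_1 assms by blast
  define u where "u = a ^ (n - 1)"
  have inverse: "[u * a = 1] (mod p)"
    using \<open>[a ^ n = 1] (mod p)\<close> \<open>0 < n\<close> by (simp only: u_def power_minus_mult)
  define d where "d = (1 - u) * (i - j)"
  have "[(1 - u) * a = - (1 - a)] (mod p)"
    using cong_diff[OF cong_refl[of a] inverse] by (simp add: algebra_simps)
  then have "coprime ((1 - u) * a) p"
    using \<open>coprime (1 - a) p\<close> by (metis cong_imp_coprime cong_sym coprime_minus_left_iff)
  then have "coprime d p"
    using \<open>coprime (i - j) p\<close> by (simp add: d_def)
  moreover have "x + d \<in> S" if "x \<in> S" for x
  proof (rule cong)
    show "u * (a * x + (1 - a) * j) + (1 - u) * i \<in> S"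
      unfolding u_def using that assms by (intro affine_power affine)
    have "[u * a * (x - j) + (u * j + (1 - u) * i) = 1 * (x - j) + (u * j + (1 - u) * i)] (mod p)"
      by (intro cong_add cong_mult inverse cong_refl)
    then show "[u * (a * x + (1 - a) * j) + (1 - u) * i = x + d] (mod p)"
      by (simp add: d_def algebra_simps)
  qed
  ultimately show ?thesis
    using translation_closed_eq_UNIV \<open>0 < p\<close> \<open>i \<in> S\<close> cong by blast
qed

section \<open>Idempotent right modular groupoids\<close>

context W_groupoid
begin

declare closed [simp] idem [simp]

lemma mult_mult_right [simp]: "x \<in> carrier \<Longrightarrow> y \<in> carrier \<Longrightarrow> (x \<cdot> y) \<cdot> y = y \<cdot> x"
  using right_modular[of x y y] by simp

lemma flexible: "x \<in> carrier \<Longrightarrow> y \<in> carrier \<Longrightarrow> (x \<cdot> y) \<cdot> x = x \<cdot> (y \<cdot> x)"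
  using mult_mult_right[of "y \<cdot> x" x] by simp

lemma medial:
  assumes "x \<in> carrier" "y \<in> carrier" "z \<in> carrier" "w \<in> carrier"
  shows "(x \<cdot> y) \<cdot> (z \<cdot> w) = (x \<cdot> z) \<cdot> (y \<cdot> w)"
proof -
  have "(x \<cdot> y) \<cdot> (z \<cdot> w) = ((z \<cdot> w) \<cdot> y) \<cdot> x"
    using assms by (intro right_modular) simp_all
  also have "(z \<cdot> w) \<cdot> y = (y \<cdot> w) \<cdot> z"
    using assms by (intro right_modular)
  also have "\<dots> \<cdot> x = (x \<cdot> z) \<cdot> (y \<cdot> w)"
    using assms by (intro right_modular) simp_all
  finally show ?thesis .
qed

lemma right_distrib:
  "x \<in> carrier \<Longrightarrow> y \<in> carrier \<Longrightarrow> z \<in> carrier \<Longrightarrow> (x \<cdot> y) \<cdot> z = (x \<cdot> z) \<cdot> (y \<cdot> z)"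
  using medial[of x y z z] by simp

lemma left_distrib:
  "x \<in> carrier \<Longrightarrow> y \<in> carrier \<Longrightarrow> z \<in> carrier \<Longrightarrow> x \<cdot> (y \<cdot> z) = (x \<cdot> y) \<cdot> (x \<cdot> z)"
  using medial[of x x y z] by simp

end

section \<open>Orbits of a right multiplication\<close>

locale W_groupoid_pair = W_groupoid +
  fixes e f :: 'a
  assumes e_in_carrier [simp]: "e \<in> carrier" and f_in_carrier [simp]: "f \<in> carrier"
begin

(* keeps the concrete indices of \<xi> below as numerals *)
declare One_nat_def [simp del] One_nat_def [symmetric, simp]

definition orbit :: "nat \<Rightarrow> 'a" (\<open>\<xi>\<close>) where
  "\<xi> k = ((\<lambda>x. x \<cdot> f) ^^ k) e"

lemma orbit_0: "\<xi> 0 = e"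
  by (simp add: orbit_def)

lemma orbit_Suc: "\<xi> (Suc k) = \<xi> k \<cdot> f"
  by (simp add: orbit_def)

lemma orbit_1: "\<xi> 1 = e \<cdot> f"
  using orbit_Suc[of 0] by (simp add: orbit_0)

lemma orbit_numeral: "\<xi> (numeral k) = \<xi> (pred_numeral k) \<cdot> f"
  by (simp add: numeral_eq_Suc orbit_Suc)

lemma orbit_in_carrier [simp]: "\<xi> k \<in> carrier"
  by (induction k) (simp_all add: orbit_0 orbit_Suc)

lemma mult_orbit: "f \<cdot> \<xi> k = \<xi> (Suc (Suc k))"
  by (simp add: orbit_Suc)

lemma orbit_mult_shift: "(\<xi> i \<cdot> \<xi> j) \<cdot> f = \<xi> (Suc i) \<cdot> \<xi> (Suc j)"
  unfolding orbit_Suc by (intro right_distrib) simp_all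

lemma orbit_exchange: "\<xi> (Suc i) \<cdot> \<xi> j = \<xi> (Suc j) \<cdot> \<xi> i"
  unfolding orbit_Suc by (intro right_modular) simp_all

lemma orbit_mult_below: "\<xi> (Suc (Suc k)) \<cdot> \<xi> k = \<xi> (Suc k)"
  using orbit_exchange[of "Suc k" k] by simp

lemma orbit_flexible: "\<xi> k \<cdot> \<xi> (Suc (Suc k)) = \<xi> (Suc k) \<cdot> \<xi> k"
  using flexible[of "\<xi> k" f] by (simp add: mult_orbit flip: orbit_Suc)

lemma orbit_mult_e: "\<xi> 2 \<cdot> e = \<xi> 1" "\<xi> 3 \<cdot> e = \<xi> 1 \<cdot> \<xi> 2"
  using orbit_mult_below[of 0] orbit_exchange[of 2 0] by (simp_all add: orbit_0)

lemma orbit_periodic: "\<xi> n = e \<Longrightarrow> \<xi> (k + n) = \<xi> k"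
  by (simp add: orbit_def funpow_add)

lemma orbit_mult_f:
  "e \<cdot> f = \<xi> 1" "\<xi> 1 \<cdot> f = \<xi> 2" "\<xi> 2 \<cdot> f = \<xi> 3" "\<xi> 3 \<cdot> f = \<xi> 4" "\<xi> 4 \<cdot> f = \<xi> 5"
  by (simp_all add: orbit_1 orbit_numeral)

lemma orbit_words:
  "\<xi> 1 = e \<cdot> f" "\<xi> 2 = f \<cdot> e" "\<xi> 3 = (f \<cdot> e) \<cdot> f" "\<xi> 4 = f \<cdot> (f \<cdot> e)"
  by (simp_all add: orbit_1 orbit_numeral)

lemma orbit_4_eq: "\<xi> 4 = ((f \<cdot> e) \<cdot> f) \<cdot> f"
  by (simp add: orbit_1 orbit_numeral)

lemma orbit_5_eq: "\<xi> 5 = f \<cdot> ((f \<cdot> e) \<cdot> f)"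
  by (simp add: orbit_1 orbit_numeral flexible)

lemma fixed_mult_orbit_Suc:
  assumes "z \<in> carrier" and "z \<cdot> f = z"
  shows "z \<cdot> \<xi> (Suc k) = (z \<cdot> \<xi> k) \<cdot> f" and "\<xi> (Suc k) \<cdot> z = (\<xi> k \<cdot> z) \<cdot> f"
  using assms right_distrib[of z "\<xi> k" f] right_distrib[of "\<xi> k" z f]
  by (simp_all add: orbit_Suc)

lemma orbit_1_eq_2_if_orbit_2_eq_3:
  assumes "\<xi> 2 = \<xi> 3"
  shows "\<xi> 1 = \<xi> 2"
proof -
  have "\<xi> 1 = \<xi> 1 \<cdot> \<xi> 2"
    using assms orbit_mult_e by metis
  then have "\<xi> 1 = \<xi> 2 \<cdot> \<xi> 1"
    using mult_mult_right[of "\<xi> 1" "\<xi> 2"] by simp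
  also have "\<dots> = \<xi> 3 \<cdot> \<xi> 1"
    using assms by simp
  also have "\<dots> = \<xi> 2"
    using orbit_mult_below[of 1] by simp
  finally show ?thesis .
qed

lemma period_4_if_gfg:
  assumes gfg: "\<xi> 2 \<cdot> \<xi> 1 = e"
  shows "\<xi> 4 = e"
proof -
  define y where "y = e \<cdot> \<xi> 1"
  have y_in_carrier: "y \<in> carrier"
    by (simp add: y_def)
  have y_eq: "y = \<xi> 1 \<cdot> \<xi> 2"
    using gfg mult_mult_right[of "\<xi> 2" "\<xi> 1"] by (simp add: y_def)
  then have "y \<cdot> f = y"
    using orbit_mult_shift[of 0 1] by (simp add: y_def orbit_0)
  note shift = fixed_mult_orbit_Suc[OF y_in_carrier this]
  have "\<xi> 1 \<cdot> \<xi> 3 = e"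
    using gfg orbit_flexible[of 1] by simp
  then have "e \<cdot> \<xi> 3 = \<xi> 2"
    using mult_mult_right[of "\<xi> 1" "\<xi> 3"] orbit_mult_below[of 1] by simp
  moreover have "y \<cdot> e = e \<cdot> \<xi> 3"
    using y_eq orbit_mult_e(2)[symmetric] by simp
  ultimately have "y \<cdot> \<xi> 1 = \<xi> 3"
    using shift(1)[of 0] by (simp add: orbit_0 orbit_mult_f)
  then have "\<xi> 4 = y \<cdot> \<xi> 2"
    using shift(1)[of 1] by (simp add: orbit_mult_f)
  also have "\<dots> = (\<xi> 2 \<cdot> \<xi> 1) \<cdot> e"
    unfolding y_def by (intro right_modular) simp_all
  finally show ?thesis
    using gfg by simp
qed

lemma period_3_if_ggf:
  assumes ggf: "\<xi> 1 \<cdot> \<xi> 2 = e"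
  shows "\<xi> 3 = e"
proof -
  define z where "z = \<xi> 1 \<cdot> e"
  have z_in_carrier [simp]: "z \<in> carrier"
    by (simp add: z_def)
  have "z = e \<cdot> \<xi> 2"
    using orbit_flexible[of 0] by (simp add: z_def orbit_0)
  then have z_eq: "z = \<xi> 2 \<cdot> \<xi> 1"
    using ggf mult_mult_right[of "\<xi> 1" "\<xi> 2"] by simp
  then have z_fixed: "z \<cdot> f = z"
    using orbit_mult_shift[of 1 0] by (simp add: z_def orbit_0)
  note shift = fixed_mult_orbit_Suc[OF z_in_carrier z_fixed]
  have "\<xi> 3 \<cdot> e = e"
    using ggf orbit_mult_e(2) by simp
  then have "e = (\<xi> 1 \<cdot> \<xi> 2) \<cdot> \<xi> 3"
    using ggf mult_mult_right[of "\<xi> 3" e] by simp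
  also have "\<dots> = (\<xi> 3 \<cdot> \<xi> 2) \<cdot> \<xi> 1"
    by (intro right_modular) simp_all
  also have "\<xi> 3 \<cdot> \<xi> 2 = z"
    using orbit_mult_shift[of 2 1] z_eq z_fixed by simp
  finally have z_mult_1: "z \<cdot> \<xi> 1 = e" by simp
  have z_mult_e: "z \<cdot> e = \<xi> 1 \<cdot> z"
    using z_mult_1 mult_mult_right[of z "\<xi> 1"] by (simp add: z_def)
  then have "\<xi> 2 \<cdot> z = e"
    using z_mult_1 shift(1)[of 0] shift(2)[of 1] by (simp add: orbit_0)
  then have "e \<cdot> z = z \<cdot> \<xi> 2"
    using mult_mult_right[of "\<xi> 2" z] by simp
  also have "\<dots> = \<xi> 1"
    using z_mult_1 shift(1)[of 1] by (simp add: orbit_mult_f)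
  finally have "z \<cdot> e = \<xi> 2"
    using z_mult_e shift(2)[of 0] by (simp add: orbit_0 orbit_mult_f)
  then have "z \<cdot> \<xi> 1 = \<xi> 3"
    using shift(1)[of 0] by (simp add: orbit_0 orbit_mult_f)
  then show ?thesis
    using z_mult_1 by simp
qed

end

section \<open>Affine families\<close>

context groupoid
begin

lemma quasigroup_if_finite_inj:
  assumes "finite carrier"
    and left: "\<And>a. a \<in> carrier \<Longrightarrow> inj_on (\<lambda>x. a \<cdot> x) carrier"
    and right: "\<And>a. a \<in> carrier \<Longrightarrow> inj_on (\<lambda>x. x \<cdot> a) carrier"
  shows "quasigroup carrier (\<cdot>)"
proof
  have unique_preimage: "\<exists>!x. x \<in> carrier \<and> h x = b"
    if "inj_on h carrier" "h ` carrier \<subseteq> carrier" "b \<in> carrier" for h b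
  proof -
    have "h ` carrier = carrier"
      using that \<open>finite carrier\<close> by (intro endo_inj_surj)
    then show ?thesis
      using that by (metis imageE inj_onD)
  qed
  fix a b assume "a \<in> carrier" "b \<in> carrier"
  show "\<exists>!x. x \<in> carrier \<and> a \<cdot> x = b"
    using \<open>a \<in> carrier\<close> \<open>b \<in> carrier\<close> by (intro unique_preimage left image_subsetI closed)
  show "\<exists>!y. y \<in> carrier \<and> y \<cdot> a = b"
    using \<open>a \<in> carrier\<close> \<open>b \<in> carrier\<close> by (intro unique_preimage right image_subsetI closed)
qed

end

locale affine_family = W_groupoid +
  fixes p a :: int and \<phi> :: "int \<Rightarrow> 'a"
  assumes prime_p: "prime p"
    and not_dvd_a: "\<not> p dvd a" and not_dvd_1_minus_a: "\<not> p dvd 1 - a"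
    and family_in_carrier [simp]: "\<phi> n \<in> carrier"
    and family_cong: "[x = y] (mod p) \<Longrightarrow> \<phi> x = \<phi> y"
begin

lemma p_pos: "0 < p"
  using prime_p by (rule prime_gt_0_int)

lemma coprime_a: "coprime a p" and coprime_1_minus_a: "coprime (1 - a) p"
  using prime_p not_dvd_a not_dvd_1_minus_a by (metis coprime_commute prime_imp_coprime)+

definition affine_column :: "'a \<Rightarrow> int \<Rightarrow> bool" where
  "affine_column g k \<longleftrightarrow> g \<in> carrier \<and> (\<forall>n. \<phi> n \<cdot> g = \<phi> (a * n + (1 - a) * k))"

lemma affine_columnI:
  assumes "g \<in> carrier"
    and column: "\<And>n. n \<in> {0..<p} \<Longrightarrow> \<phi> n \<cdot> g = \<phi> (a * n + (1 - a) * k)"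
  shows "affine_column g k"
proof -
  have "\<phi> n \<cdot> g = \<phi> (a * n + (1 - a) * k)" for n
  proof -
    have "n mod p \<in> {0..<p}"
      using p_pos by simp
    moreover have "[n mod p = n] (mod p)"
      by (simp add: cong_def)
    then have "\<phi> (n mod p) = \<phi> n"
      and "\<phi> (a * (n mod p) + (1 - a) * k) = \<phi> (a * n + (1 - a) * k)"
      by (intro family_cong cong_add cong_mult cong_refl; assumption)+
    ultimately show ?thesis
      using column by metis
  qed
  with \<open>g \<in> carrier\<close> show ?thesis
    by (simp add: affine_column_def)
qed

lemma affine_column_mult:
  assumes "affine_column g k" and "affine_column h l"
  shows "affine_column (g \<cdot> h) (a * k + (1 - a) * l)"
proof -
  have in_carrier: "g \<in> carrier" "h \<in> carrier"
    and g: "\<phi> n \<cdot> g = \<phi> (a * n + (1 - a) * k)" and h: "\<phi> n \<cdot> h = \<phi> (a * n + (1 - a) * l)" for n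
    using assms by (simp_all add: affine_column_def)
  have "\<phi> n \<cdot> (g \<cdot> h) = \<phi> (a * n + (1 - a) * (a * k + (1 - a) * l))" for n
  proof -
    obtain m where m: "[a * m = n - (1 - a) * l] (mod p)"
      using cong_solve_linear coprime_a by blast
    have "\<phi> n = \<phi> m \<cdot> h"
      using cong_add[OF m cong_refl, of "(1 - a) * l"] by (auto simp: h intro: family_cong cong_sym)
    then have "\<phi> n \<cdot> (g \<cdot> h) = (\<phi> m \<cdot> g) \<cdot> h"
      using in_carrier by (simp add: right_distrib[of "\<phi> m" g h])
    also have "\<dots> = \<phi> (a * (a * m + (1 - a) * k) + (1 - a) * l)"
      by (simp add: g h)
    also have "\<dots> = \<phi> (a * (n - (1 - a) * l + (1 - a) * k) + (1 - a) * l)"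
      by (intro family_cong cong_add cong_mult cong_refl m)
    finally show ?thesis
      by (simp add: algebra_simps)
  qed
  with in_carrier show ?thesis
    by (simp add: affine_column_def)
qed

lemma affine_mult_if_columns:
  assumes h: "affine_column h i" and j: "affine_column (\<phi> j) j" and "coprime (i - j) p"
  shows "\<phi> x \<cdot> \<phi> y = \<phi> (a * x + (1 - a) * y)"
proof -
  define S where "S = {y. affine_column (\<phi> y) y}"
  have "S = UNIV"
  proof (rule affine_closed_eq_UNIV[where p = p and a = a and i = "a * j + (1 - a) * i" and j = j])
    show "y \<in> S" if "x \<in> S" "[x = y] (mod p)" for x y
    proof -
      have "\<phi> y = \<phi> x"
        using that by (auto intro: family_cong cong_sym)
      moreover have "\<phi> (a * n + (1 - a) * x) = \<phi> (a * n + (1 - a) * y)" for n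
        using that by (intro family_cong cong_add cong_mult cong_refl)
      ultimately show ?thesis
        using that by (simp add: S_def affine_column_def)
    qed
    show "a * x + (1 - a) * y \<in> S" if "x \<in> S" "y \<in> S" for x y
      using that affine_column_mult[of "\<phi> x" x "\<phi> y" y] by (simp add: S_def affine_column_def)
    have "(a * j + (1 - a) * i) - j = (1 - a) * (i - j)"
      by (simp add: algebra_simps)
    then show "coprime ((a * j + (1 - a) * i) - j) p"
      using coprime_1_minus_a \<open>coprime (i - j) p\<close> by simp
    show "j \<in> S"
      using j by (simp add: S_def)
    show "a * j + (1 - a) * i \<in> S"
      using h affine_column_mult[OF j h] by (simp add: S_def affine_column_def)
  qed (fact p_pos coprime_a coprime_1_minus_a)+
  then have "affine_column (\<phi> y) y"
    unfolding S_def by blast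
  then show ?thesis
    by (simp add: affine_column_def)
qed

end

locale affine_one_step_W_groupoid = one_step_W_groupoid + affine_family +
  assumes affine_mult: "\<phi> x \<cdot> \<phi> y = \<phi> (a * x + (1 - a) * y)"
    and nonconstant: "\<exists>x y. \<phi> x \<noteq> \<phi> y"
    and not_dvd_2_a_minus_1: "\<not> p dvd 2 * a - 1"
begin

lemma family_eq_iff: "\<phi> x = \<phi> y \<longleftrightarrow> [x = y] (mod p)"
proof
  assume "\<phi> x = \<phi> y"
  show "[x = y] (mod p)"
  proof (rule ccontr)
    assume "\<not> [x = y] (mod p)"
    have "{z. \<phi> z = \<phi> y} = UNIV"
    proof (rule affine_closed_eq_UNIV[where p = p and a = a and i = x and j = y])
      show "coprime (x - y) p"
        using \<open>\<not> [x = y] (mod p)\<close> prime_p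
        by (metis cong_iff_dvd_diff coprime_commute prime_imp_coprime)
      show "a * s + (1 - a) * t \<in> {z. \<phi> z = \<phi> y}"
        if "s \<in> {z. \<phi> z = \<phi> y}" "t \<in> {z. \<phi> z = \<phi> y}" for s t
        using that affine_mult[of s t] by simp
    qed (use \<open>\<phi> x = \<phi> y\<close> family_cong p_pos coprime_a coprime_1_minus_a in auto)
    then have "\<phi> z = \<phi> y" for z
      by blast
    then show False
      using nonconstant by metis
  qed
qed (rule family_cong)

lemma range_family: "range \<phi> = carrier"
proof -
  have "subgroupoid (range \<phi>) carrier (\<cdot>)"
    by (auto simp: subgroupoid_def groupoid_def affine_mult)
  moreover have "\<phi> 1 \<cdot> \<phi> 0 \<noteq> \<phi> 0 \<cdot> \<phi> 1"
    using not_dvd_2_a_minus_1 by (simp add: affine_mult family_eq_iff cong_iff_dvd_diff)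
  then have "\<not> commutative_on (range \<phi>) (\<cdot>)"
    unfolding commutative_on_def by blast
  ultimately show ?thesis
    using proper_commutative by blast
qed

lemma family_image: "\<phi> ` {0..<p} = carrier"
proof -
  have "\<phi> n \<in> \<phi> ` {0..<p}" for n
    by (rule image_eqI[of _ _ "n mod p"])
      (use p_pos in \<open>auto simp: family_eq_iff cong_def\<close>)
  then show ?thesis
    using range_family by blast
qed

lemma left_cancel:
  assumes "x \<in> carrier" "y \<in> carrier" "z \<in> carrier" and "x \<cdot> y = x \<cdot> z"
  shows "y = z"
proof -
  obtain i j k where "x = \<phi> i" "y = \<phi> j" "z = \<phi> k"
    using assms range_family by (metis imageE)
  then show ?thesis
    using assms coprime_1_minus_a
    by (simp add: affine_mult family_eq_iff cong_add_lcancel cong_mult_lcancel)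
qed

lemma right_cancel:
  assumes "x \<in> carrier" "y \<in> carrier" "z \<in> carrier" and "y \<cdot> x = z \<cdot> x"
  shows "y = z"
proof -
  obtain i j k where "x = \<phi> i" "y = \<phi> j" "z = \<phi> k"
    using assms range_family by (metis imageE)
  then show ?thesis
    using assms coprime_a
    by (simp add: affine_mult family_eq_iff cong_add_rcancel cong_mult_lcancel)
qed

lemma quasigroup: "quasigroup carrier (\<cdot>)"
proof (rule quasigroup_if_finite_inj)
  show "finite carrier"
    unfolding family_image[symmetric] by simp
qed (auto intro: inj_onI left_cancel right_cancel)

lemma has_cayley_table_family:
  assumes "distinct ks" and "set ks = {0..<p}"
  shows "has_cayley_table carrier (\<cdot>) (map \<phi> ks)
    (map (\<lambda>x. map (\<lambda>y. \<phi> ((a * x + (1 - a) * y) mod p)) ks) ks)"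
proof -
  have "inj_on \<phi> {0..<p}"
    by (auto simp: inj_on_def family_eq_iff cong_def)
  moreover have "\<phi> (n mod p) = \<phi> n" for n
    by (simp add: family_eq_iff)
  ultimately show ?thesis
    using assms family_image by (simp add: has_cayley_table_def distinct_map affine_mult)
qed

end

definition cyclic_nth :: "'a list \<Rightarrow> int \<Rightarrow> 'a" where
  "cyclic_nth xs n = xs ! nat (n mod int (length xs))"

lemma cyclic_nth_in_set: "xs \<noteq> [] \<Longrightarrow> cyclic_nth xs n \<in> set xs"
  by (simp add: cyclic_nth_def nat_less_iff)

lemma cyclic_nth_cong: "[x = y] (mod int (length xs)) \<Longrightarrow> cyclic_nth xs x = cyclic_nth xs y"
  by (simp add: cyclic_nth_def cong_def)

locale one_step_W_groupoid_pair = one_step_W_groupoid + W_groupoid_pair +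
  assumes noncommuting: "e \<cdot> f \<noteq> f \<cdot> e"
begin

lemma cyclic_nth_affine:
  assumes "prime p" and "\<not> p dvd a" and "\<not> p dvd 1 - a" and "\<not> p dvd 2 * a - 1"
    and length: "int (length xs) = p" and "set xs \<subseteq> carrier" and e: "cyclic_nth xs 1 = e"
    and column_f: "\<And>n. n \<in> {0..<p} \<Longrightarrow> cyclic_nth xs n \<cdot> f = cyclic_nth xs (a * n)"
    and column_e: "\<And>n. n \<in> {0..<p} \<Longrightarrow> cyclic_nth xs n \<cdot> e = cyclic_nth xs (a * n + (1 - a))"
  shows "affine_one_step_W_groupoid carrier (\<cdot>) p a (cyclic_nth xs)"
proof -
  let ?\<phi> = "cyclic_nth xs"
  have "xs \<noteq> []"
    using length \<open>prime p\<close> by auto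
  interpret affine_family carrier "(\<cdot>)" p a ?\<phi>
  proof
    show "?\<phi> n \<in> carrier" for n
      using cyclic_nth_in_set[OF \<open>xs \<noteq> []\<close>] \<open>set xs \<subseteq> carrier\<close> by blast
    show "?\<phi> x = ?\<phi> y" if "[x = y] (mod p)" for x y
      using that length by (intro cyclic_nth_cong) simp
  qed fact+
  have f: "affine_column f 0"
    by (rule affine_columnI) (simp_all add: column_f)
  then have mult_f: "?\<phi> n \<cdot> f = ?\<phi> (a * n)" for n
    by (simp add: affine_column_def)
  have "affine_column (?\<phi> 1) 1"
    by (rule affine_columnI) (simp_all add: e column_e)
  with f have affine_mult: "?\<phi> x \<cdot> ?\<phi> y = ?\<phi> (a * x + (1 - a) * y)" for x y
    by (rule affine_mult_if_columns) simp
  have ef: "?\<phi> a = e \<cdot> f"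
    using mult_f[of 1] e by simp
  then have "?\<phi> (a * a) = f \<cdot> e"
    using mult_f[of a] by simp
  with ef noncommuting have nonconstant: "\<exists>x y. ?\<phi> x \<noteq> ?\<phi> y"
    by metis
  then show ?thesis
    using affine_mult \<open>\<not> p dvd 2 * a - 1\<close> by unfold_locales
qed

end

section \<open>The two periods\<close>

context W_groupoid_pair
begin

lemma orbit_products_if_period_4:
  assumes "\<xi> 4 = e"
  shows "\<xi> 1 \<cdot> e = \<xi> 3" and "\<xi> 3 \<cdot> e = e \<cdot> \<xi> 1" and "e \<cdot> \<xi> 3 = \<xi> 2"
    and "(e \<cdot> \<xi> 1) \<cdot> e = \<xi> 2" and "(e \<cdot> \<xi> 1) \<cdot> f = e \<cdot> \<xi> 1"
proof -
  have orbit_5: "\<xi> 5 = \<xi> 1"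
    using assms orbit_periodic[of 4 1] by simp
  have "e \<cdot> \<xi> 2 = \<xi> 3"
    using assms orbit_exchange[of 3 2] by simp
  then show mult_1_0: "\<xi> 1 \<cdot> e = \<xi> 3"
    using orbit_flexible[of 0] by (simp add: orbit_0)
  then show mult_3_0: "\<xi> 3 \<cdot> e = e \<cdot> \<xi> 1"
    using mult_mult_right[of "\<xi> 1" e] by simp
  have "\<xi> 1 \<cdot> \<xi> 3 = e"
    using assms orbit_5 orbit_exchange[of 4 3] by simp
  then show "e \<cdot> \<xi> 3 = \<xi> 2"
    using mult_mult_right[of "\<xi> 1" "\<xi> 3"] orbit_mult_below[of 1] by simp
  then show "(e \<cdot> \<xi> 1) \<cdot> e = \<xi> 2"
    using mult_1_0 by (simp add: flexible)
  show "(e \<cdot> \<xi> 1) \<cdot> f = e \<cdot> \<xi> 1"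
    using mult_3_0 orbit_mult_shift[of 0 1] orbit_mult_e(2) by (simp add: orbit_0)
qed

lemma orbit_products_if_period_5:
  assumes "\<xi> 5 = e"
  shows "\<xi> 4 \<cdot> e = \<xi> 2 \<cdot> \<xi> 1" and "\<xi> 2 \<cdot> \<xi> 3 = e \<cdot> \<xi> 4" and "\<xi> 3 \<cdot> \<xi> 4 = \<xi> 1 \<cdot> e"
    and "\<xi> 4 \<cdot> \<xi> 1 = e \<cdot> \<xi> 4" and "\<xi> 3 \<cdot> \<xi> 2 = e \<cdot> \<xi> 1"
    and "e \<cdot> \<xi> 3 = \<xi> 4" and "\<xi> 4 \<cdot> \<xi> 2 = \<xi> 3" and "\<xi> 2 \<cdot> \<xi> 4 = e \<cdot> \<xi> 1"
proof -
  have orbit_6: "\<xi> 6 = \<xi> 1"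
    using assms orbit_periodic[of 5 1] by simp
  show mult_4_1: "\<xi> 4 \<cdot> \<xi> 1 = e \<cdot> \<xi> 4"
    using assms orbit_6 orbit_flexible[of 4] by simp
  then show "\<xi> 2 \<cdot> \<xi> 3 = e \<cdot> \<xi> 4"
    using orbit_exchange[of 3 1] by simp
  show "\<xi> 3 \<cdot> \<xi> 4 = \<xi> 1 \<cdot> e"
    using assms orbit_exchange[of 2 4] orbit_flexible[of 0] by (simp add: orbit_0)
  show mult_4_0: "\<xi> 4 \<cdot> e = \<xi> 2 \<cdot> \<xi> 1"
    using assms orbit_6 orbit_exchange[of 3 5] orbit_flexible[of 1] by simp
  show "\<xi> 3 \<cdot> \<xi> 2 = e \<cdot> \<xi> 1"
    using assms orbit_6 mult_4_0 orbit_mult_shift[of 2 1] orbit_mult_shift[of 4 5] by simp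
  show "e \<cdot> \<xi> 3 = \<xi> 4"
    using assms orbit_mult_below[of 3] by simp
  show "\<xi> 4 \<cdot> \<xi> 2 = \<xi> 3"
    using orbit_mult_below[of 2] by simp
  show "\<xi> 2 \<cdot> \<xi> 4 = e \<cdot> \<xi> 1"
    using assms orbit_exchange[of 4 1] by simp
qed

lemma nested_orbit_products_if_period_5:
  assumes "\<xi> 5 = e"
  shows "\<xi> 4 \<cdot> (\<xi> 1 \<cdot> \<xi> 2) = e \<cdot> \<xi> 1" and "(e \<cdot> \<xi> 4) \<cdot> (\<xi> 2 \<cdot> \<xi> 1) = \<xi> 2"
proof -
  note products = orbit_products_if_period_5[OF assms]
  have "\<xi> 4 \<cdot> (\<xi> 1 \<cdot> \<xi> 2) = (\<xi> 4 \<cdot> \<xi> 1) \<cdot> (\<xi> 4 \<cdot> \<xi> 2)"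
    by (intro left_distrib) simp_all
  also have "\<dots> = (\<xi> 2 \<cdot> \<xi> 3) \<cdot> \<xi> 3"
    by (simp only: products)
  also have "\<dots> = \<xi> 3 \<cdot> \<xi> 2"
    by simp
  also have "\<dots> = e \<cdot> \<xi> 1"
    by (rule products)
  finally show "\<xi> 4 \<cdot> (\<xi> 1 \<cdot> \<xi> 2) = e \<cdot> \<xi> 1" .
  have "(\<xi> 1 \<cdot> \<xi> 2) \<cdot> (\<xi> 1 \<cdot> e) = ((\<xi> 1 \<cdot> e) \<cdot> \<xi> 2) \<cdot> \<xi> 1"
    by (intro right_modular) simp_all
  also have "(\<xi> 1 \<cdot> e) \<cdot> \<xi> 2 = (\<xi> 2 \<cdot> e) \<cdot> \<xi> 1"
    by (intro right_modular) simp_all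
  also have "\<dots> \<cdot> \<xi> 1 = \<xi> 1"
    by (simp add: orbit_mult_e)
  finally have "((\<xi> 1 \<cdot> \<xi> 2) \<cdot> f) \<cdot> ((\<xi> 1 \<cdot> e) \<cdot> f) = \<xi> 2"
    using right_distrib[of "\<xi> 1 \<cdot> \<xi> 2" "\<xi> 1 \<cdot> e" f] by (simp add: orbit_mult_f)
  then show "(e \<cdot> \<xi> 4) \<cdot> (\<xi> 2 \<cdot> \<xi> 1) = \<xi> 2"
    using orbit_mult_shift[of 1 2] orbit_mult_shift[of 1 0] products by (simp add: orbit_0)
qed

lemma mult_e_if_period_5:
  assumes "\<xi> 5 = e"
  shows "(\<xi> 1 \<cdot> \<xi> 2) \<cdot> e = \<xi> 4" and "(e \<cdot> \<xi> 4) \<cdot> e = \<xi> 3" and "(\<xi> 2 \<cdot> \<xi> 1) \<cdot> e = e \<cdot> \<xi> 4"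
    and "(e \<cdot> \<xi> 1) \<cdot> e = e \<cdot> (\<xi> 1 \<cdot> e)" and "(e \<cdot> (\<xi> 1 \<cdot> e)) \<cdot> e = \<xi> 2"
proof -
  note products = orbit_products_if_period_5[OF assms]
  show mult_12_0: "(\<xi> 1 \<cdot> \<xi> 2) \<cdot> e = \<xi> 4"
    using products mult_mult_right[of "\<xi> 3" e] by (simp add: orbit_mult_e)
  have "(e \<cdot> \<xi> 4) \<cdot> e = (\<xi> 2 \<cdot> \<xi> 3) \<cdot> e"
    by (simp add: products)
  also have "\<dots> = (e \<cdot> \<xi> 3) \<cdot> \<xi> 2"
    by (intro right_modular) simp_all
  finally show "(e \<cdot> \<xi> 4) \<cdot> e = \<xi> 3"
    by (simp add: products)
  show "(\<xi> 2 \<cdot> \<xi> 1) \<cdot> e = e \<cdot> \<xi> 4"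
    using products mult_mult_right[of "\<xi> 4" e] by simp
  show "(e \<cdot> \<xi> 1) \<cdot> e = e \<cdot> (\<xi> 1 \<cdot> e)"
    by (rule flexible) simp_all
  then have "(e \<cdot> (\<xi> 1 \<cdot> e)) \<cdot> e = e \<cdot> (e \<cdot> \<xi> 1)"
    using mult_mult_right[of "e \<cdot> \<xi> 1" e] by simp
  also have "\<dots> = e \<cdot> (\<xi> 4 \<cdot> (\<xi> 1 \<cdot> \<xi> 2))"
    by (simp add: nested_orbit_products_if_period_5[OF assms])
  also have "\<dots> = (e \<cdot> \<xi> 4) \<cdot> (e \<cdot> (\<xi> 1 \<cdot> \<xi> 2))"
    by (intro left_distrib) simp_all
  also have "e \<cdot> (\<xi> 1 \<cdot> \<xi> 2) = \<xi> 2 \<cdot> \<xi> 1"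
    using mult_12_0 products mult_mult_right[of "\<xi> 1 \<cdot> \<xi> 2" e] by simp
  also have "(e \<cdot> \<xi> 4) \<cdot> (\<xi> 2 \<cdot> \<xi> 1) = \<xi> 2"
    by (rule nested_orbit_products_if_period_5[OF assms])
  finally show "(e \<cdot> (\<xi> 1 \<cdot> e)) \<cdot> e = \<xi> 2" .
qed

lemma mult_f_if_period_5:
  assumes "\<xi> 5 = e"
  shows "(\<xi> 1 \<cdot> \<xi> 2) \<cdot> f = e \<cdot> \<xi> 4" and "(e \<cdot> \<xi> 4) \<cdot> f = \<xi> 1 \<cdot> e" and "(\<xi> 1 \<cdot> e) \<cdot> f = \<xi> 2 \<cdot> \<xi> 1"
    and "(\<xi> 2 \<cdot> \<xi> 1) \<cdot> f = e \<cdot> \<xi> 1" and "(e \<cdot> \<xi> 1) \<cdot> f = \<xi> 1 \<cdot> \<xi> 2"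
    and "(e \<cdot> (\<xi> 1 \<cdot> e)) \<cdot> f = e \<cdot> (\<xi> 1 \<cdot> e)"
proof -
  note products = orbit_products_if_period_5[OF assms]
  show "(\<xi> 1 \<cdot> \<xi> 2) \<cdot> f = e \<cdot> \<xi> 4"
    using products orbit_mult_shift[of 1 2] by simp
  show mult_04_f: "(e \<cdot> \<xi> 4) \<cdot> f = \<xi> 1 \<cdot> e"
    using assms orbit_mult_shift[of 0 4] by (simp add: orbit_0)
  show "(\<xi> 1 \<cdot> e) \<cdot> f = \<xi> 2 \<cdot> \<xi> 1"
    using orbit_mult_shift[of 1 0] by (simp add: orbit_0)
  show "(\<xi> 2 \<cdot> \<xi> 1) \<cdot> f = e \<cdot> \<xi> 1"
    using products orbit_mult_shift[of 2 1] by simp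
  show "(e \<cdot> \<xi> 1) \<cdot> f = \<xi> 1 \<cdot> \<xi> 2"
    using orbit_mult_shift[of 0 1] by (simp add: orbit_0)
  have "e \<cdot> (\<xi> 1 \<cdot> e) = e \<cdot> (\<xi> 3 \<cdot> \<xi> 4)"
    by (simp add: products)
  also have "\<dots> = (e \<cdot> \<xi> 3) \<cdot> (e \<cdot> \<xi> 4)"
    by (intro left_distrib) simp_all
  finally have zero_eq: "e \<cdot> (\<xi> 1 \<cdot> e) = \<xi> 4 \<cdot> (e \<cdot> \<xi> 4)"
    by (simp add: products)
  have "\<xi> 4 \<cdot> (e \<cdot> \<xi> 4) \<cdot> f = (\<xi> 4 \<cdot> f) \<cdot> ((e \<cdot> \<xi> 4) \<cdot> f)"
    by (intro right_distrib) simp_all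
  also have "\<dots> = e \<cdot> (\<xi> 1 \<cdot> e)"
    using assms orbit_Suc[of 4] by (simp add: mult_04_f)
  finally show "(e \<cdot> (\<xi> 1 \<cdot> e)) \<cdot> f = e \<cdot> (\<xi> 1 \<cdot> e)"
    by (simp add: zero_eq)
qed

abbreviation family_5 :: "int \<Rightarrow> 'a" where
  "family_5 \<equiv> cyclic_nth [e \<cdot> \<xi> 1, e, \<xi> 1, \<xi> 3, \<xi> 2]"

abbreviation family_11 :: "int \<Rightarrow> 'a" where
  "family_11 \<equiv> cyclic_nth [e \<cdot> (\<xi> 1 \<cdot> e), e, \<xi> 1 \<cdot> \<xi> 2, \<xi> 1, \<xi> 4, \<xi> 3, e \<cdot> \<xi> 4,
     \<xi> 1 \<cdot> e, e \<cdot> \<xi> 1, \<xi> 2, \<xi> 2 \<cdot> \<xi> 1]"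

end

context one_step_W_groupoid_pair
begin

lemma affine_family_5:
  assumes "\<xi> 4 = e"
  shows "affine_one_step_W_groupoid carrier (\<cdot>) 5 2 family_5"
proof -
  note entries = cyclic_nth_def nth_Cons' assms orbit_mult_e(1) orbit_mult_f
    orbit_products_if_period_4[OF assms]
  have residues: "{0..<5::int} = {0, 1, 2, 3, 4}"
    by auto
  have "family_5 n \<cdot> f = family_5 (2 * n)" if "n \<in> {0..<5}" for n
    using that unfolding residues
    by (elim insertE emptyE) (simp_all add: entries)
  moreover have "family_5 n \<cdot> e = family_5 (2 * n + (1 - 2))" if "n \<in> {0..<5}" for n
    using that unfolding residues
    by (elim insertE emptyE) (simp_all add: entries)
  ultimately show ?thesis
    by (intro cyclic_nth_affine) (simp_all add: cyclic_nth_def)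
qed

lemma affine_family_11:
  assumes "\<xi> 5 = e"
  shows "affine_one_step_W_groupoid carrier (\<cdot>) 11 3 family_11"
proof -
  note entries = cyclic_nth_def nth_Cons' assms orbit_mult_e orbit_mult_f
    orbit_products_if_period_5[OF assms] mult_e_if_period_5[OF assms] mult_f_if_period_5[OF assms]
  have residues: "{0..<11::int} = {0, 1, 2, 3, 4, 5, 6, 7, 8, 9, 10}"
    by auto presburger
  have "family_11 n \<cdot> f = family_11 (3 * n)" if "n \<in> {0..<11}" for n
    using that unfolding residues
    by (elim insertE emptyE) (simp_all add: entries)
  moreover have "family_11 n \<cdot> e = family_11 (3 * n + (1 - 3))" if "n \<in> {0..<11}" for n
    using that unfolding residues
    by (elim insertE emptyE) (simp_all add: entries)
  ultimately show ?thesis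
    by (intro cyclic_nth_affine) (simp_all add: cyclic_nth_def)
qed

lemma quasigroup_if_period_4:
  assumes "\<xi> 4 = e"
  shows "quasigroup carrier (\<cdot>)"
  using affine_family_5[OF assms] affine_one_step_W_groupoid.quasigroup by blast

lemma quasigroup_if_period_5:
  assumes "\<xi> 5 = e"
  shows "quasigroup carrier (\<cdot>)"
  using affine_family_11[OF assms] affine_one_step_W_groupoid.quasigroup by blast

lemma cayley_table_if_period_4:
  assumes "\<xi> 4 = e"
  shows "has_cayley_table carrier (\<cdot>) [e, f, \<xi> 1, \<xi> 2, \<xi> 3]
    [[e, \<xi> 1, f, \<xi> 3, \<xi> 2],
     [\<xi> 2, f, \<xi> 3, e, \<xi> 1],
     [\<xi> 3, \<xi> 2, \<xi> 1, f, e],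
     [\<xi> 1, \<xi> 3, e, \<xi> 2, f],
     [f, e, \<xi> 2, \<xi> 1, \<xi> 3]]"
proof -
  interpret affine_one_step_W_groupoid carrier "(\<cdot>)" 5 2 family_5
    by (rule affine_family_5[OF assms])
  have entries: "family_5 1 = e" "family_5 2 = \<xi> 1" "family_5 3 = \<xi> 3" "family_5 4 = \<xi> 2"
    by (simp_all add: cyclic_nth_def nth_Cons')
  have "e \<cdot> family_5 0 = e \<cdot> f"
    using affine_mult[of 1 0] by (simp add: entries orbit_mult_f)
  then have "family_5 0 = f"
    by (rule left_cancel[rotated -1]) simp_all
  have "set [1, 0, 2, 4, 3] = {0..<5::int}"
    by auto
  then show ?thesis
    using has_cayley_table_family[of "[1, 0, 2, 4, 3]"] by (simp add: entries \<open>family_5 0 = f\<close>)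
qed

lemma cayley_table_if_period_5:
  assumes "\<xi> 5 = e"
  shows "let xs = [e, \<xi> 1, \<xi> 2, \<xi> 3, \<xi> 4, e \<cdot> \<xi> 1, \<xi> 1 \<cdot> e,
      \<xi> 1 \<cdot> \<xi> 2, \<xi> 2 \<cdot> \<xi> 1, e \<cdot> \<xi> 4, e \<cdot> (\<xi> 1 \<cdot> e)] in
    has_cayley_table carrier (\<cdot>) xs (labelled xs
            [[1, 6, 7, 5, 10, 3, 11, 9, 4, 8, 2],
             [7, 2, 8, 9, 1, 5, 10, 4, 11, 6, 3],
             [2, 9, 3, 10, 6, 11, 8, 1, 7, 5, 4],
             [8, 3, 6, 4, 7, 9, 1, 11, 10, 2, 5],
             [9, 10, 4, 8, 5, 7, 3, 6, 2, 11, 1],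
             [11, 7, 10, 2, 4, 6, 9, 3, 5, 1, 8],
             [6, 5, 2, 11, 8, 4, 7, 10, 1, 3, 9],
             [5, 11, 9, 7, 3, 1, 2, 8, 6, 4, 10],
             [10, 8, 1, 3, 11, 2, 4, 5, 9, 7, 6],
             [4, 1, 11, 6, 9, 8, 5, 2, 3, 10, 7],
             [3, 4, 5, 1, 2, 10, 6, 7, 8, 9, 11]])"
    (is "let xs = ?xs in ?table xs")
proof -
  interpret affine_one_step_W_groupoid carrier "(\<cdot>)" 11 3 family_11
    by (rule affine_family_11[OF assms])
  let ?ks = "[1, 3, 9, 5, 4, 8, 7, 2, 10, 6, 0] :: int list"
  have "set ?ks = {0..<11}"
    by auto presburger
  then have "has_cayley_table carrier (\<cdot>) (map family_11 ?ks)
      (map (\<lambda>x. map (\<lambda>y. family_11 ((3 * x + (1 - 3) * y) mod 11)) ?ks) ?ks)"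
    by (intro has_cayley_table_family) simp
  then have "?table (map family_11 ?ks)"
    by (simp add: labelled_def nth_Cons')
  moreover have "map family_11 ?ks = ?xs"
    by (simp add: cyclic_nth_def nth_Cons')
  ultimately show "let xs = ?xs in ?table xs"
    by (simp only: Let_def)
qed

end

section \<open>Words\<close>

lemma word_norm_le: "word_norm m e f (word_value m e f w) \<le> word_length w"
  unfolding word_norm_def by (rule Least_le) blast

lemma word_norm_attained:
  assumes "x \<in> range (word_value m e f)"
  obtains w where "word_value m e f w = x" and "word_length w = word_norm m e f x"
proof -
  have "\<exists>w. word_value m e f w = x \<and> word_length w = word_norm m e f x"
    unfolding word_norm_def by (rule LeastI_ex) (use assms in auto)
  then show thesis
    using that by blast
qed

lemma word_length_pos: "0 < word_length w"
  by (induction w) simp_all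

lemma word_length_eq_1: "word_length w = 1 \<longleftrightarrow> w \<in> {F, EF}"
proof (cases w)
  case (Prod u v)
  then show ?thesis
    using word_length_pos[of u] word_length_pos[of v] by simp
qed simp_all

context W_groupoid_pair
begin

lemma word_value_in_carrier: "word_value (\<cdot>) e f w \<in> carrier"
  by (induction w) simp_all

lemma word_value_length_1: "word_length w = 1 \<Longrightarrow> word_value (\<cdot>) e f w \<in> {f, \<xi> 1}"
  by (auto simp: word_length_eq_1 orbit_mult_f)

lemma word_value_length_2:
  assumes "word_length w = 2"
  shows "word_value (\<cdot>) e f w \<in> {f, \<xi> 1, \<xi> 2, \<xi> 3}"
proof (cases w)
  case (Prod u v)
  then have "word_length u = 1" "word_length v = 1"
    using assms word_length_pos[of u] word_length_pos[of v] by simp_all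
  then show ?thesis
    using word_value_length_1[of u] word_value_length_1[of v]
    by (auto simp: Prod orbit_mult_f mult_orbit)
qed (use assms in simp_all)

lemma word_value_length_3:
  assumes "word_length w = 3"
  shows "word_value (\<cdot>) e f w \<in> {f, \<xi> 1, \<xi> 2, \<xi> 3, \<xi> 4, \<xi> 5, \<xi> 1 \<cdot> \<xi> 2, \<xi> 2 \<cdot> \<xi> 1}"
proof (cases w)
  case (Prod u v)
  have products: "\<xi> 3 \<cdot> \<xi> 1 = \<xi> 2" "\<xi> 1 \<cdot> \<xi> 3 = \<xi> 2 \<cdot> \<xi> 1"
    using orbit_mult_below[of 1] orbit_flexible[of 1] by simp_all
  consider (one_two) "word_length u = 1" "word_length v = 2"
    | (two_one) "word_length u = 2" "word_length v = 1"
    using Prod assms word_length_pos[of u] word_length_pos[of v] by fastforce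
  then show ?thesis
  proof cases
    case one_two
    then show ?thesis
      using word_value_length_1[of u] word_value_length_2[of v]
      by (auto simp: Prod orbit_mult_f mult_orbit products)
  next
    case two_one
    then show ?thesis
      using word_value_length_2[of u] word_value_length_1[of v]
      by (auto simp: Prod orbit_mult_f mult_orbit products)
  qed
qed (use assms in simp_all)

end

context one_step_W_groupoid_pair
begin

lemma range_word_value: "range (word_value (\<cdot>) e f) = carrier"
proof -
  have "word_value (\<cdot>) e f u \<cdot> word_value (\<cdot>) e f v \<in> range (word_value (\<cdot>) e f)" for u v
    by (rule range_eqI[of _ _ "Prod u v"]) simp
  then have "subgroupoid (range (word_value (\<cdot>) e f)) carrier (\<cdot>)"
    using word_value_in_carrier by (auto simp: subgroupoid_def groupoid_def)
  moreover have "\<not> commutative_on (range (word_value (\<cdot>) e f)) (\<cdot>)"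
  proof
    assume "commutative_on (range (word_value (\<cdot>) e f)) (\<cdot>)"
    then have "word_value (\<cdot>) e f EF \<cdot> word_value (\<cdot>) e f F
        = word_value (\<cdot>) e f F \<cdot> word_value (\<cdot>) e f EF"
      unfolding commutative_on_def by blast
    then have "\<xi> 2 = \<xi> 3"
      by (simp add: orbit_mult_f mult_orbit)
    then show False
      using orbit_1_eq_2_if_orbit_2_eq_3 noncommuting by (simp add: orbit_words)
  qed
  ultimately show ?thesis
    using proper_commutative by blast
qed

lemma period_4_or_5_if_word_norm_3:
  assumes "word_norm (\<cdot>) e f e = 3"
  shows "\<xi> 4 = e \<or> \<xi> 5 = e"
proof -
  obtain w where w: "word_value (\<cdot>) e f w = e" "word_length w = 3"
    using assms range_word_value word_norm_attained[of e "(\<cdot>)" e f] by force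
  have "word_value (\<cdot>) e f u \<noteq> e" if "word_length u < 3" for u
    using that assms word_norm_le[of "(\<cdot>)" e f u] by auto
  from this[of F] this[of EF] this[of "Prod EF F"] this[of "Prod F EF"]
  have "f \<noteq> e" "\<xi> 1 \<noteq> e" "\<xi> 2 \<noteq> e" "\<xi> 3 \<noteq> e"
    by (simp_all add: orbit_mult_f mult_orbit)
  then have "\<xi> 4 = e \<or> \<xi> 5 = e \<or> \<xi> 1 \<cdot> \<xi> 2 = e \<or> \<xi> 2 \<cdot> \<xi> 1 = e"
    using word_value_length_3[OF w(2)] w(1) by auto
  then show ?thesis
    using period_4_if_gfg period_3_if_ggf \<open>\<xi> 3 \<noteq> e\<close> by blast
qed

end

theorem theorem18:
  fixes G :: "'a set" and mult :: "'a \<Rightarrow> 'a \<Rightarrow> 'a" (infixl "\<cdot>" 70) and e f :: 'a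
  assumes "one_step_W_groupoid G (\<cdot>)"
    and "e \<in> G" and "f \<in> G" and "e \<noteq> f" and "e \<cdot> f \<noteq> f \<cdot> e"
    and "G = generated_subgroupoid G (\<cdot>) {e, f}"
    and "word_norm (\<cdot>) e f e = 3"
  shows "quasigroup G (\<cdot>)
    \<and> (e = ((f \<cdot> e) \<cdot> f) \<cdot> f \<or> e = f \<cdot> ((f \<cdot> e) \<cdot> f))
    \<and> (e = ((f \<cdot> e) \<cdot> f) \<cdot> f \<longrightarrow>
        (let ef = e \<cdot> f; fe = f \<cdot> e; fef = (f \<cdot> e) \<cdot> f in
          has_cayley_table G (\<cdot>) [e, f, ef, fe, fef]
            [[e,   ef,  f,   fef, fe],
             [fe,  f,   fef, e,   ef],
             [fef, fe,  ef,  f,   e],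
             [ef,  fef, e,   fe,  f],
             [f,   e,   fe,  ef,  fef]]))
    \<and> (e = f \<cdot> ((f \<cdot> e) \<cdot> f) \<longrightarrow>
        (let xs = [e, e \<cdot> f, f \<cdot> e, (f \<cdot> e) \<cdot> f, f \<cdot> (f \<cdot> e), e \<cdot> (e \<cdot> f), (e \<cdot> f) \<cdot> e,
                   (e \<cdot> f) \<cdot> (f \<cdot> e), (f \<cdot> e) \<cdot> (e \<cdot> f), e \<cdot> (f \<cdot> (f \<cdot> e)), e \<cdot> ((e \<cdot> f) \<cdot> e)] in
          has_cayley_table G (\<cdot>) xs (labelled xs
            [[1, 6, 7, 5, 10, 3, 11, 9, 4, 8, 2],
             [7, 2, 8, 9, 1, 5, 10, 4, 11, 6, 3],
             [2, 9, 3, 10, 6, 11, 8, 1, 7, 5, 4],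
             [8, 3, 6, 4, 7, 9, 1, 11, 10, 2, 5],
             [9, 10, 4, 8, 5, 7, 3, 6, 2, 11, 1],
             [11, 7, 10, 2, 4, 6, 9, 3, 5, 1, 8],
             [6, 5, 2, 11, 8, 4, 7, 10, 1, 3, 9],
             [5, 11, 9, 7, 3, 1, 2, 8, 6, 4, 10],
             [10, 8, 1, 3, 11, 2, 4, 5, 9, 7, 6],
             [4, 1, 11, 6, 9, 8, 5, 2, 3, 10, 7],
             [3, 4, 5, 1, 2, 10, 6, 7, 8, 9, 11]])))"
proof -
  interpret one_step_W_groupoid G "(\<cdot>)"
    by (fact assms(1))
  interpret one_step_W_groupoid_pair G "(\<cdot>)" e f
    by unfold_locales (fact assms)+
  have period_iff: "e = ((f \<cdot> e) \<cdot> f) \<cdot> f \<longleftrightarrow> \<xi> 4 = e" "e = f \<cdot> ((f \<cdot> e) \<cdot> f) \<longleftrightarrow> \<xi> 5 = e"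
    unfolding orbit_4_eq orbit_5_eq by auto
  have period: "\<xi> 4 = e \<or> \<xi> 5 = e"
    using assms(7) by (rule period_4_or_5_if_word_norm_3)
  then have "quasigroup G (\<cdot>)"
    using quasigroup_if_period_4 quasigroup_if_period_5 by blast
  with period show ?thesis
    using cayley_table_if_period_4 cayley_table_if_period_5
    unfolding period_iff orbit_words Let_def by blast
qed

end
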